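(* For any $0 < \kappa < 1$ and any $m\ge 1$, the grid packing problem on an $m \times m$ grid admits an $(O(m^\kappa \log m), O(1/\kappa))$-approximate solution.
   Context: Grid packing on an $m\times m$ table of cells: a solution is a (multi)set of segments, each segment being a set of consecutive cells within a single row or within a single column. A segment $A$ precedes a segment $B$ if every cell of $A$ is strictly higher than every cell of $B$ and strictly to the right of every cell of $B$; two segments are non-conflicting if one precedes the other, and a set of segments is non-conflicting if every pair in it is. For an assignment of non-negative numbers to the cells, the score of a set of cells is the sum of its numbers; the score of the table is the maximum score of a path of $2m-1$ cells from the bottom-left cell to the top-right cell in which each step moves one cell up or one cell to the right. A solution is $(\alpha,\beta)$-approximate if every cell is covered by at most $\alpha$ segments, and for every assignment of non-negative numbers to the cells there is a non-conflicting set of segments of the solution whose total score (sum of the segments' scores) is at least $1/\beta$ times the score of the table. (The segments are chosen before, and independently of, the numbers.)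
   Formalization: The factor log m is replaced by max(1, log₂ m), because at m = 1 the bound m^κ log m is 0 while the single cell must be covered; for m ≥ 2 the bound is unchanged, with absolute constants uniform in κ and m. *)

theory Defs
  imports Complex_Main "HOL-Library.Multiset"
begin

text \<open>A cell is a pair (row, column), both counted from 0; rows are numbered from the bottom
  upwards and columns from left to right.\<close>

type_synonym cell = "nat \<times> nat"

definition cells :: "nat \<Rightarrow> cell set" where
  "cells m = {..<m} \<times> {..<m}"

definition segment :: "nat \<Rightarrow> cell set \<Rightarrow> bool" where
  "segment m A \<longleftrightarrow>
     (\<exists>r a b. r < m \<and> a \<le> b \<and> b < m \<and> (A = {r} \<times> {a..b} \<or> A = {a..b} \<times> {r}))"

definition precedes :: "cell set \<Rightarrow> cell set \<Rightarrow> bool" where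
  "precedes A B \<longleftrightarrow> (\<forall>x\<in>A. \<forall>y\<in>B. fst x > fst y \<and> snd x > snd y)"

definition non_conflicting :: "cell set set \<Rightarrow> bool" where
  "non_conflicting T \<longleftrightarrow> (\<forall>A\<in>T. \<forall>B\<in>T. A \<noteq> B \<longrightarrow> precedes A B \<or> precedes B A)"

definition score :: "(cell \<Rightarrow> real) \<Rightarrow> cell set \<Rightarrow> real" where
  "score w A = sum w A"

definition up_right_step :: "cell \<Rightarrow> cell \<Rightarrow> bool" where
  "up_right_step x y \<longleftrightarrow> y = (Suc (fst x), snd x) \<or> y = (fst x, Suc (snd x))"

definition grid_path :: "nat \<Rightarrow> cell list \<Rightarrow> bool" where
  "grid_path m p \<longleftrightarrow>
     length p = 2 * m - 1 \<and> set p \<subseteq> cells m \<and>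
     hd p = (0, 0) \<and> last p = (m - 1, m - 1) \<and>
     (\<forall>i. Suc i < length p \<longrightarrow> up_right_step (p ! i) (p ! Suc i))"

text \<open>For \<open>m \<ge> 1\<close> the set of paths is finite and non-empty, so \<open>Max\<close> is a true maximum.\<close>

definition table_score :: "nat \<Rightarrow> (cell \<Rightarrow> real) \<Rightarrow> real" where
  "table_score m w = Max {score w (set p) | p. grid_path m p}"

definition grid_solution :: "nat \<Rightarrow> cell set multiset \<Rightarrow> bool" where
  "grid_solution m S \<longleftrightarrow> (\<forall>A\<in>#S. segment m A)"

text \<open>Coverage counts multiplicities. The chosen non-conflicting family can be a plain set, since
  two copies of a (non-empty) segment never precede each other. The condition \<open>\<beta> > 0\<close> is needed
  because \<open>1 / 0 = 0\<close>.\<close>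

definition approximate_solution ::
    "nat \<Rightarrow> real \<Rightarrow> real \<Rightarrow> cell set multiset \<Rightarrow> bool" where
  "approximate_solution m \<alpha> \<beta> S \<longleftrightarrow>
     grid_solution m S \<and> \<beta> > 0 \<and>
     (\<forall>x\<in>cells m. real (size {#A \<in># S. x \<in> A#}) \<le> \<alpha>) \<and>
     (\<forall>w. (\<forall>x\<in>cells m. w x \<ge> 0) \<longrightarrow>
        (\<exists>T \<subseteq> set_mset S. non_conflicting T \<and>
           (\<Sum>A\<in>T. score w A) \<ge> 1 / \<beta> * table_score m w))"

end

theory Submission
  imports Defs
begin

text \<open>Split an optimal path into the cells left by a step to the right and the cells left by a step
  up; one of the two classes carries half of the score. Right-step cells in distinct rows lie in
  strictly increasing columns, so segments inside the column hulls of these rows never conflict, and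
  symmetrically for up-step cells. It remains to choose few intervals such that every interval
  contains one carrying an \<open>\<Omega>(\<kappa>)\<close> fraction of its weight. With \<open>B\<close> about
  \<open>m powr (\<kappa> / 2)\<close> take, on each scale \<open>B ^ d\<close>, all unions of at most \<open>B\<close> consecutive aligned
  blocks: a point lies in at most \<open>B\<^sup>2\<close> of them per scale, there are \<open>O(min (1 / \<kappa>) (log m))\<close> scales,
  and every interval is a disjoint union of at most two of them per scale and one more.\<close>

section \<open>Decomposing intervals into blocks of several scales\<close>

text \<open>The endpoints \<open>u\<close> and \<open>v\<close> stand for the half-open interval
  \<open>{u..<v}\<close>, so neighbouring blocks share an endpoint and sums over them concatenate.
  The case \<open>d = 0\<close> supplies all singletons once \<open>B > 0\<close>.\<close>

definition block :: "nat \<Rightarrow> nat \<Rightarrow> nat \<Rightarrow> nat \<Rightarrow> bool" where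
  "block B D u v \<longleftrightarrow> (\<exists>d\<le>D. \<exists>i j. u = i * B ^ d \<and> v = j * B ^ d \<and> i < j \<and> j \<le> i + B)"

lemma blockI: "d \<le> D \<Longrightarrow> i < j \<Longrightarrow> j \<le> i + B \<Longrightarrow> block B D (i * B ^ d) (j * B ^ d)"
  unfolding block_def by blast

lemma block_less: "B > 0 \<Longrightarrow> block B D u v \<Longrightarrow> u < v"
  unfolding block_def by auto

lemma ex_multiple_above:
  fixes a s :: nat
  assumes "s > 0"
  obtains k where "a \<le> k * s" "k * s < a + s"
proof (cases "s dvd a")
  case True
  then show ?thesis using assms that[of "a div s"] by simp
next
  case False
  have "(a div s) * s + a mod s = a" by simp
  moreover have "a mod s > 0" using False by (simp add: mod_greater_zero_iff_not_dvd)
  moreover have "a mod s < s" using assms by simp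
  ultimately show ?thesis using that[of "Suc (a div s)"] unfolding mult_Suc by linarith
qed

lemma sum_split3:
  fixes f :: "nat \<Rightarrow> real"
  assumes "a \<le> x" "x \<le> y" "y \<le> b"
  shows "sum f {a..<b} = sum f {a..<x} + sum f {x..<y} + sum f {y..<b}"
  using sum.atLeastLessThan_concat[of a x b f] sum.atLeastLessThan_concat[of x y b f] assms by simp

text \<open>Rounding \<open>a\<close> up to a multiple of the next finer scale splits off a piece of
  fewer than \<open>B\<close> fine blocks, hence at most one \<open>block\<close>; what is left
  satisfies the same hypotheses one scale lower. Each of the \<open>d\<close> scales thus costs at
  most one \<open>M\<close>, where \<open>M\<close> bounds every block inside the interval.\<close>

lemma sum_le_left_of_multiple:
  fixes f :: "nat \<Rightarrow> real"
  assumes "B > 0" "M \<ge> 0" "d \<le> D" "a \<le> k * B ^ d" "k * B ^ d < a + B ^ d"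
    and "\<And>u v. block B D u v \<Longrightarrow> a \<le> u \<Longrightarrow> v \<le> k * B ^ d \<Longrightarrow> sum f {u..<v} \<le> M"
  shows "sum f {a..<k * B ^ d} \<le> d * M"
  using assms(3-)
proof (induction d arbitrary: k)
  case 0
  then show ?case by simp
next
  case (Suc d)
  let ?s = "B ^ d"
  have s: "?s > 0" using \<open>B > 0\<close> by simp
  obtain l where l: "a \<le> l * ?s" "l * ?s < a + ?s" using ex_multiple_above[OF s] by blast
  have b: "k * B ^ Suc d = (k * B) * ?s" by simp
  have "l * ?s < (k * B + 1) * ?s"
    using l(2) Suc.prems(2) unfolding b by (simp add: algebra_simps)
  then have le: "l \<le> k * B" using s by (simp only: mult_less_cancel2) simp
  then have les: "l * ?s \<le> k * B ^ Suc d" unfolding b by simp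
  have "(k * B) * ?s < (l + B) * ?s"
    using l(1) Suc.prems(3) unfolding b by (simp add: algebra_simps)
  then have short: "k * B < l + B" using s by (simp only: mult_less_cancel2)
  have "sum f {a..<l * ?s} \<le> d * M"
  proof (rule Suc.IH[OF _ l])
    show "d \<le> D" using Suc.prems(1) by simp
    show "sum f {u..<v} \<le> M" if "block B D u v" "a \<le> u" "v \<le> l * ?s" for u v
      by (rule Suc.prems(4)[OF that(1,2) le_trans[OF that(3) les]])
  qed
  moreover have "sum f {l * ?s..<k * B ^ Suc d} \<le> M"
  \<comment> \<open>A \<open>block\<close> is never empty when \<open>B > 0\<close>, so the empty
    piece has to be bounded through \<open>M \<ge> 0\<close>.\<close>
  proof (cases "l = k * B")
    case True
    then show ?thesis using \<open>M \<ge> 0\<close> by simp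
  next
    case False
    then have "block B D (l * ?s) (k * B ^ Suc d)"
      unfolding b using blockI[of d D l "k * B" B] le short Suc.prems(1) by simp
    then show ?thesis using Suc.prems(4) l by simp
  qed
  moreover have "sum f {a..<k * B ^ Suc d} = sum f {a..<l * ?s} + sum f {l * ?s..<k * B ^ Suc d}"
    using sum_split3[OF l(1) les order_refl, of f] by simp
  ultimately show ?case by (simp add: algebra_simps)
qed

text \<open>Mirror image of \<open>sum_le_left_of_multiple\<close>: here \<open>b\<close> is rounded
  down to a multiple of the finer scale.\<close>

lemma sum_le_right_of_multiple:
  fixes f :: "nat \<Rightarrow> real"
  assumes "B > 0" "M \<ge> 0" "d \<le> D" "k * B ^ d \<le> b" "b < k * B ^ d + B ^ d"
    and "\<And>u v. block B D u v \<Longrightarrow> k * B ^ d \<le> u \<Longrightarrow> v \<le> b \<Longrightarrow> sum f {u..<v} \<le> M"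
  shows "sum f {k * B ^ d..<b} \<le> d * M"
  using assms(3-)
proof (induction d arbitrary: k)
  case 0
  then show ?case by simp
next
  case (Suc d)
  let ?s = "B ^ d"
  have s: "?s > 0" using \<open>B > 0\<close> by simp
  define l where "l = b div ?s"
  have l: "l * ?s \<le> b" "b < l * ?s + ?s"
    using div_mult_mod_eq[of b ?s] mod_less_divisor[OF s, of b] unfolding l_def by linarith+
  have a: "k * B ^ Suc d = (k * B) * ?s" by simp
  have le: "k * B \<le> l"
    unfolding l_def using Suc.prems(2) s by (simp only: a less_eq_div_iff_mult_less_eq)
  then have les: "k * B ^ Suc d \<le> l * ?s" unfolding a by simp
  have "l * ?s < (k * B + B) * ?s"
    using l(1) Suc.prems(3) unfolding a by (simp add: algebra_simps)
  then have short: "l < k * B + B" using s by (simp only: mult_less_cancel2)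
  have "sum f {l * ?s..<b} \<le> d * M"
  proof (rule Suc.IH[OF _ l])
    show "d \<le> D" using Suc.prems(1) by simp
    show "sum f {u..<v} \<le> M" if "block B D u v" "l * ?s \<le> u" "v \<le> b" for u v
      by (rule Suc.prems(4)[OF that(1) le_trans[OF les that(2)] that(3)])
  qed
  moreover have "sum f {k * B ^ Suc d..<l * ?s} \<le> M"
  proof (cases "l = k * B")
    case True
    then show ?thesis using \<open>M \<ge> 0\<close> by simp
  next
    case False
    then have "block B D (k * B ^ Suc d) (l * ?s)"
      unfolding a using blockI[of d D "k * B" l B] le short Suc.prems(1) by simp
    then show ?thesis using Suc.prems(4) l by simp
  qed
  moreover have "sum f {k * B ^ Suc d..<b} = sum f {k * B ^ Suc d..<l * ?s} + sum f {l * ?s..<b}"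
    using sum_split3[OF les l(1) order_refl, of f] by simp
  ultimately show ?case by (simp add: algebra_simps)
qed

text \<open>Cut at the first multiple of \<open>B ^ d\<close> from \<open>a\<close> on and at the
  last one up to \<open>b\<close>. The middle is at most one block, and the two ends cost at most
  \<open>d * M\<close> each by the one-sided lemmas. If no multiple lies in between, the interval is
  short enough for the induction hypothesis.\<close>

lemma sum_le_interval:
  fixes f :: "nat \<Rightarrow> real"
  assumes "B > 0" "M \<ge> 0" "a \<le> b" "d \<le> D" "b \<le> a + B ^ d"
    and M: "\<And>u v. block B D u v \<Longrightarrow> a \<le> u \<Longrightarrow> v \<le> b \<Longrightarrow> sum f {u..<v} \<le> M"
  shows "sum f {a..<b} \<le> real (2 * d + 1) * M"
  using assms(4-5)
proof (induction d)
  case 0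
  have "sum f {a..<b} \<le> M"
  proof (cases "a = b")
    case False
    then have "b = a + 1" using 0 \<open>a \<le> b\<close> by simp
    then show ?thesis using M[OF blockI[of 0 D a "a + 1" B]] \<open>B > 0\<close> by simp
  qed (use \<open>M \<ge> 0\<close> in simp)
  then show ?case by simp
next
  case (Suc d)
  let ?s = "B ^ d"
  have s: "?s > 0" using \<open>B > 0\<close> by simp
  obtain k where k: "a \<le> k * ?s" "k * ?s < a + ?s" using ex_multiple_above[OF s] by blast
  define l where "l = b div ?s"
  have l: "l * ?s \<le> b" "b < l * ?s + ?s"
    using div_mult_mod_eq[of b ?s] mod_less_divisor[OF s, of b] unfolding l_def by linarith+
  show ?case
  proof (cases "k \<le> l")
    case True
    then have kl: "k * ?s \<le> l * ?s" by simp
    have "sum f {a..<k * ?s} \<le> d * M"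
    proof (rule sum_le_left_of_multiple[of B M d D])
      show "sum f {u..<v} \<le> M" if "block B D u v" "a \<le> u" "v \<le> k * ?s" for u v
        using M[OF that(1)] that kl l(1) by simp
    qed (use k assms(1,2) Suc.prems in auto)
    moreover have "sum f {l * ?s..<b} \<le> d * M"
    proof (rule sum_le_right_of_multiple[of B M d D])
      show "sum f {u..<v} \<le> M" if "block B D u v" "l * ?s \<le> u" "v \<le> b" for u v
        using M[OF that(1)] that kl k(1) by simp
    qed (use l assms(1,2) Suc.prems in auto)
    moreover have "sum f {k * ?s..<l * ?s} \<le> M"
    proof (cases "k = l")
      case False
      \<comment> \<open>The middle may consist of exactly \<open>B\<close> blocks of size
        \<open>?s\<close>, namely when \<open>a\<close> is a multiple of \<open>?s\<close> and the
        length is \<open>B ^ Suc d\<close>; the bound \<open>j \<le> i + B\<close> in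
        \<open>block\<close> just admits this.\<close>
      have "l * ?s \<le> (k + B) * ?s"
        using k(1) l(1) Suc.prems(2) by (simp add: algebra_simps)
      then have "l \<le> k + B" using s mult_le_cancel2 by blast
      then show ?thesis using False True M[OF blockI[of d D k l B]] k l Suc.prems by simp
    qed (use \<open>M \<ge> 0\<close> in simp)
    ultimately show ?thesis
      using sum_split3[OF k(1) kl l(1), of f] \<open>M \<ge> 0\<close> by (simp add: algebra_simps)
  next
    case False
    \<comment> \<open>The first multiple after \<open>b\<close> is at most \<open>k * ?s\<close>,
      which is below \<open>a + ?s\<close>.\<close>
    then have "(l + 1) * ?s \<le> k * ?s" by (intro mult_le_mono1) simp
    then have "b \<le> a + ?s" using k l by simp
    then have "sum f {a..<b} \<le> real (2 * d + 1) * M" using Suc by simp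
    also have "\<dots> \<le> real (2 * Suc d + 1) * M" using \<open>M \<ge> 0\<close> by (intro mult_right_mono) auto
    finally show ?thesis .
  qed
qed

text \<open>The largest weight of a block inside the interval is an admissible \<open>M\<close> in
  \<open>sum_le_interval\<close>, so a block attaining it carries the required fraction.\<close>

lemma heavy_block_in_interval:
  fixes f :: "nat \<Rightarrow> real"
  assumes "B > 0" "a < b" "b \<le> B ^ D" and f: "\<And>x. a \<le> x \<Longrightarrow> x < b \<Longrightarrow> f x \<ge> 0"
  shows "\<exists>u v. block B D u v \<and> a \<le> u \<and> v \<le> b \<and> sum f {a..<b} \<le> real (2 * D + 1) * sum f {u..<v}"
proof -
  define P where "P = {(u, v). block B D u v \<and> a \<le> u \<and> v \<le> b}"
  define M where "M = Max ((\<lambda>(u, v). sum f {u..<v}) ` P)"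
  have "P \<subseteq> {..b} \<times> {..b}" unfolding P_def using block_less[OF \<open>B > 0\<close>] by fastforce
  then have fin: "finite P" by (rule finite_subset) simp
  \<comment> \<open>A singleton block makes \<open>P\<close> non-empty, so that the maximum is
    attained.\<close>
  have "(a, a + 1) \<in> P"
    unfolding P_def using blockI[of 0 D a "a + 1" B] assms(1,2) by simp
  then have "M \<in> (\<lambda>(u, v). sum f {u..<v}) ` P"
    unfolding M_def using fin by (intro Max_in) auto
  then obtain u v where uv: "block B D u v" "a \<le> u" "v \<le> b" "M = sum f {u..<v}"
    unfolding P_def by auto
  have "M \<ge> 0" unfolding uv(4) using uv f by (intro sum_nonneg) auto
  moreover have "sum f {u'..<v'} \<le> M" if "block B D u' v'" "a \<le> u'" "v' \<le> b" for u' v'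
    unfolding M_def using that fin by (intro Max_ge) (auto simp: P_def)
  ultimately have "sum f {a..<b} \<le> real (2 * D + 1) * M"
    by (intro sum_le_interval[where B = B and D = D]) (use assms in auto)
  then show ?thesis using uv by auto
qed

section \<open>Number of blocks over a point\<close>

lemma card_blocks_containing:
  assumes "B > 0"
  shows "finite {(u, v). block B D u v \<and> u \<le> y \<and> y < v}" (is "finite ?P")
    and "card {(u, v). block B D u v \<and> u \<le> y \<and> y < v} \<le> (D + 1) * (B * B)"
proof -
  \<comment> \<open>At scale \<open>d\<close>, a block over \<open>y\<close> is determined by how
    many aligned pieces it has to the left (\<open>k\<close>) and to the right (\<open>l\<close>) of
    the piece containing \<open>y\<close>; both numbers are below \<open>B\<close>.\<close>
  define g where
    "g = (\<lambda>(d, k, l). ((y div B ^ d - k) * B ^ d, (y div B ^ d + 1 + l) * B ^ d))"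
  let ?I = "{..D} \<times> {..<B} \<times> {..<B}"
  have sub: "?P \<subseteq> g ` ?I"
  proof clarify
    fix u v assume "block B D u v" "u \<le> y" "y < v"
    then obtain d i j where *: "d \<le> D" "u = i * B ^ d" "v = j * B ^ d" "i < j" "j \<le> i + B"
      unfolding block_def by blast
    have "B ^ d > 0" using assms by simp
    then have "i \<le> y div B ^ d" "y div B ^ d < j"
      using * \<open>u \<le> y\<close> \<open>y < v\<close>
      by (auto simp: less_eq_div_iff_mult_less_eq div_less_iff_less_mult)
    then have "(u, v) = g (d, y div B ^ d - i, j - y div B ^ d - 1)"
      "(d, y div B ^ d - i, j - y div B ^ d - 1) \<in> ?I"
      using * unfolding g_def by (auto simp: add_mult_distrib[symmetric] simp flip: mult_Suc)
    then show "(u, v) \<in> g ` ?I" by blast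
  qed
  show "finite ?P" by (rule finite_subset[OF sub]) simp
  have "card ?P \<le> card (g ` ?I)" by (intro card_mono sub) simp
  also have "\<dots> \<le> card ?I" by (intro card_image_le) simp
  finally show "card ?P \<le> (D + 1) * (B * B)" by simp
qed

section \<open>Segments cut out of rows and columns by blocks\<close>

text \<open>As \<open>B ^ D\<close> may exceed \<open>m\<close>, the condition
  \<open>v \<le> m\<close> discards blocks that stick out of the table.\<close>

definition row_segments :: "nat \<Rightarrow> nat \<Rightarrow> nat \<Rightarrow> cell set set" where
  "row_segments B D m = {{r} \<times> {u..<v} | r u v. r < m \<and> block B D u v \<and> v \<le> m}"

text \<open>Defined by transposition, so that facts about rows carry over along
  \<open>prod.swap\<close>.\<close>

definition column_segments :: "nat \<Rightarrow> nat \<Rightarrow> nat \<Rightarrow> cell set set" where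
  "column_segments B D m = image prod.swap ` row_segments B D m"

lemma segment_row_segments:
  assumes "B > 0" "A \<in> row_segments B D m"
  shows "segment m A"
proof -
  obtain r u v where *: "A = {r} \<times> {u..<v}" "r < m" "block B D u v" "v \<le> m"
    using assms(2) unfolding row_segments_def by blast
  moreover have "u < v" using block_less[OF assms(1) *(3)] .
  moreover from this have "{u..<v} = {u..v - 1}" by auto
  ultimately have "r < m \<and> u \<le> v - 1 \<and> v - 1 < m \<and> A = {r} \<times> {u..v - 1}" by auto
  then show ?thesis unfolding segment_def by blast
qed

lemma segment_swap: "segment m A \<Longrightarrow> segment m (prod.swap ` A)"
  unfolding segment_def by (metis product_swap)

lemma segment_column_segments: "B > 0 \<Longrightarrow> A \<in> column_segments B D m \<Longrightarrow> segment m A"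
  unfolding column_segments_def using segment_row_segments segment_swap by blast

lemma finite_row_segments: "finite (row_segments B D m)"
proof (rule finite_subset)
  show "row_segments B D m \<subseteq> Pow (cells m)"
    unfolding row_segments_def cells_def by auto
qed (simp add: cells_def)

lemma finite_column_segments: "finite (column_segments B D m)"
  unfolding column_segments_def using finite_row_segments by simp

text \<open>A segment through \<open>x\<close> lies in the row of \<open>x\<close>, so it is
  determined by a block over \<open>snd x\<close>.\<close>

lemma card_row_segments_containing:
  assumes "B > 0"
  shows "card {A \<in> row_segments B D m. x \<in> A} \<le> (D + 1) * (B * B)"
proof -
  let ?P = "{(u, v). block B D u v \<and> u \<le> snd x \<and> snd x < v}"
  have "{A \<in> row_segments B D m. x \<in> A} \<subseteq> (\<lambda>(u, v). {fst x} \<times> {u..<v}) ` ?P"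
    unfolding row_segments_def by (cases x) auto
  then have "card {A \<in> row_segments B D m. x \<in> A} \<le> card ((\<lambda>(u, v). {fst x} \<times> {u..<v}) ` ?P)"
    using card_blocks_containing(1)[OF assms] by (intro card_mono) auto
  also have "\<dots> \<le> card ?P" using card_blocks_containing(1)[OF assms] by (rule card_image_le)
  also have "\<dots> \<le> (D + 1) * (B * B)" by (rule card_blocks_containing(2)[OF assms])
  finally show ?thesis .
qed

lemma card_column_segments_containing:
  assumes "B > 0"
  shows "card {A \<in> column_segments B D m. x \<in> A} \<le> (D + 1) * (B * B)"
proof -
  have "{A \<in> column_segments B D m. x \<in> A}
      = image prod.swap ` {A \<in> row_segments B D m. prod.swap x \<in> A}"
    unfolding column_segments_def by force
  then have "card {A \<in> column_segments B D m. x \<in> A}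
      \<le> card {A \<in> row_segments B D m. prod.swap x \<in> A}"
    using finite_row_segments by (simp add: card_image_le)
  then show ?thesis using card_row_segments_containing[OF assms] le_trans by blast
qed

section \<open>Heavy non-conflicting families in monotone sets of cells\<close>

text \<open>By \<open>ord\<close>, the hulls from \<open>Min (C r)\<close> to
  \<open>Max (C r)\<close> of the column sets of \<open>H\<close> in different rows are disjoint and
  move right as the row goes up. One heavy block may therefore be chosen in each hull independently,
  without creating conflicts.\<close>

lemma heavy_row_segments:
  assumes "B > 0" "m \<le> B ^ D" and w: "\<forall>x\<in>cells m. w x \<ge> 0" and H: "H \<subseteq> cells m"
    and ord: "\<And>x y. x \<in> H \<Longrightarrow> y \<in> H \<Longrightarrow> fst x < fst y \<Longrightarrow> snd x < snd y"
  shows "\<exists>T \<subseteq> row_segments B D m. non_conflicting T \<and>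
    sum w H \<le> real (2 * D + 1) * (\<Sum>A\<in>T. score w A)"
proof -
  have finH: "finite H" using finite_subset[OF H] by (simp add: cells_def)
  define R where "R = fst ` H"
  define C where "C = (\<lambda>r. {c. (r, c) \<in> H})"
  have C_eq: "C r = snd ` (H \<inter> fst -` {r})" for r unfolding C_def by force
  have finC: "finite (C r)" for r unfolding C_eq using finH by simp
  have C_ne: "C r \<noteq> {}" if "r \<in> R" for r using that unfolding R_def C_def by auto
  have "\<exists>u v. block B D u v \<and> Min (C r) \<le> u \<and> v \<le> Max (C r) + 1 \<and>
      sum (\<lambda>c. w (r, c)) (C r) \<le> real (2 * D + 1) * sum (\<lambda>c. w (r, c)) {u..<v}" if r: "r \<in> R" for r
  proof -
    have max: "Max (C r) \<in> C r" using finC C_ne r by simp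
    then have rm: "r < m" "Max (C r) < m" using H unfolding C_def cells_def by auto
    have "Min (C r) \<le> Max (C r)" using finC max by simp
    moreover have "Max (C r) + 1 \<le> B ^ D" using rm \<open>m \<le> B ^ D\<close> by simp
    moreover have nonneg: "w (r, c) \<ge> 0" if "c < Max (C r) + 1" for c
      using w rm that unfolding cells_def by simp
    ultimately obtain u v where uv: "block B D u v" "Min (C r) \<le> u" "v \<le> Max (C r) + 1"
      "sum (\<lambda>c. w (r, c)) {Min (C r)..<Max (C r) + 1} \<le> real (2 * D + 1) * sum (\<lambda>c. w (r, c)) {u..<v}"
      using heavy_block_in_interval[OF \<open>B > 0\<close>, of "Min (C r)" "Max (C r) + 1" D "\<lambda>c. w (r, c)"]
      by (metis le_imp_less_Suc Suc_eq_plus1)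
    \<comment> \<open>Filling the gaps of \<open>C r\<close> up to its hull adds only non-negative
      weights.\<close>
    have "sum (\<lambda>c. w (r, c)) (C r) \<le> sum (\<lambda>c. w (r, c)) {Min (C r)..<Max (C r) + 1}"
      by (rule sum_mono2) (use finC nonneg in \<open>auto simp: less_Suc_eq_le\<close>)
    then show ?thesis using uv by fastforce
  qed
  then obtain u v where uv: "\<And>r. r \<in> R \<Longrightarrow> block B D (u r) (v r)"
    "\<And>r. r \<in> R \<Longrightarrow> Min (C r) \<le> u r" "\<And>r. r \<in> R \<Longrightarrow> v r \<le> Max (C r) + 1"
    "\<And>r. r \<in> R \<Longrightarrow> sum (\<lambda>c. w (r, c)) (C r) \<le> real (2 * D + 1) * sum (\<lambda>c. w (r, c)) {u r..<v r}"
    by metis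
  define S where "S = (\<lambda>r. {r} \<times> {u r..<v r})"
  have less: "u r < v r" if "r \<in> R" for r using block_less[OF \<open>B > 0\<close> uv(1)[OF that]] .
  have mem: "(r, Min (C r)) \<in> H" "(r, Max (C r)) \<in> H" if "r \<in> R" for r
    using Min_in[OF finC C_ne[OF that]] Max_in[OF finC C_ne[OF that]] unfolding C_def by auto
  have prec: "precedes (S r') (S r)" if "r \<in> R" "r' \<in> R" "r < r'" for r r'
  proof -
    \<comment> \<open>\<open>ord\<close> is applied to the rightmost cell of the lower row and the
      leftmost cell of the higher one.\<close>
    have "Max (C r) < Min (C r')" using ord[OF mem(2)[OF that(1)] mem(1)[OF that(2)]] that by simp
    then have "v r \<le> u r'" using uv(2)[OF that(2)] uv(3)[OF that(1)] by simp
    then show ?thesis unfolding precedes_def S_def using that by auto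
  qed
  have "S ` R \<subseteq> row_segments B D m"
  proof
    fix A assume "A \<in> S ` R"
    then obtain r where r: "r \<in> R" "A = S r" by blast
    have "(r, Max (C r)) \<in> cells m" using mem(2)[OF r(1)] H by blast
    then show "A \<in> row_segments B D m"
      unfolding row_segments_def r(2) S_def
      using uv(1,3)[OF r(1)] by (force simp: cells_def)
  qed
  moreover have "non_conflicting (S ` R)"
    unfolding non_conflicting_def using prec by (metis (no_types, lifting) imageE linorder_neqE_nat)
  moreover have "sum w H \<le> real (2 * D + 1) * (\<Sum>A\<in>S ` R. score w A)"
  proof -
    \<comment> \<open>Non-empty segments of distinct rows are distinct, so no weight is lost when
      the family is turned into a set.\<close>
    have inj: "inj_on S R"
    proof (rule inj_onI)
      fix r r' assume *: "r \<in> R" "r' \<in> R" "S r = S r'"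
      have "(r, u r) \<in> S r" using less[OF *(1)] unfolding S_def by simp
      then show "r = r'" using *(3) unfolding S_def by auto
    qed
    have score_S: "score w (S r) = sum (\<lambda>c. w (r, c)) {u r..<v r}" for r
    proof -
      have "S r = Pair r ` {u r..<v r}" unfolding S_def by auto
      then show ?thesis unfolding score_def by (simp add: sum.reindex inj_on_def)
    qed
    have "H = Sigma R C" unfolding R_def C_def by force
    then have "sum w H = (\<Sum>r\<in>R. \<Sum>c\<in>C r. w (r, c))"
      using finH finC by (simp add: R_def sum.Sigma)
    also have "\<dots> \<le> (\<Sum>r\<in>R. real (2 * D + 1) * sum (\<lambda>c. w (r, c)) {u r..<v r})"
      by (intro sum_mono uv(4))
    also have "\<dots> = real (2 * D + 1) * (\<Sum>r\<in>R. score w (S r))"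
      by (simp add: score_S sum_distrib_left)
    also have "\<dots> = real (2 * D + 1) * (\<Sum>A\<in>S ` R. score w A)"
      using inj by (simp add: sum.reindex)
    finally show ?thesis .
  qed
  ultimately show ?thesis by blast
qed

lemma precedes_swap: "precedes A B \<Longrightarrow> precedes (prod.swap ` A) (prod.swap ` B)"
  unfolding precedes_def by auto

text \<open>Transposing the table turns \<open>ord\<close> into the hypothesis of
  \<open>heavy_row_segments\<close>, and \<open>precedes\<close> is invariant because it asks for
  both strict inequalities in the same direction.\<close>

lemma heavy_column_segments:
  assumes "B > 0" "m \<le> B ^ D" and w: "\<forall>x\<in>cells m. w x \<ge> 0" and V: "V \<subseteq> cells m"
    and ord: "\<And>x y. x \<in> V \<Longrightarrow> y \<in> V \<Longrightarrow> snd x < snd y \<Longrightarrow> fst x < fst y"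
  shows "\<exists>T \<subseteq> column_segments B D m. non_conflicting T \<and>
    sum w V \<le> real (2 * D + 1) * (\<Sum>A\<in>T. score w A)"
proof -
  have "\<exists>T \<subseteq> row_segments B D m. non_conflicting T \<and>
    sum (w \<circ> prod.swap) (prod.swap ` V) \<le> real (2 * D + 1) * (\<Sum>A\<in>T. score (w \<circ> prod.swap) A)"
    by (rule heavy_row_segments[OF assms(1,2), where w = "w \<circ> prod.swap" and H = "prod.swap ` V"]) (use w V ord in \<open>auto simp: cells_def\<close>)
  then obtain T where T: "T \<subseteq> row_segments B D m" "non_conflicting T"
    "sum (w \<circ> prod.swap) (prod.swap ` V) \<le> real (2 * D + 1) * (\<Sum>A\<in>T. score (w \<circ> prod.swap) A)"
    by blast
  have "non_conflicting (image prod.swap ` T)"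
    unfolding non_conflicting_def
  proof clarify
    fix A B assume "A \<in> T" "B \<in> T" "prod.swap ` A \<noteq> prod.swap ` B"
      "\<not> precedes (prod.swap ` B) (prod.swap ` A)"
    moreover from this have "precedes A B \<or> precedes B A"
      using T(2) unfolding non_conflicting_def by metis
    ultimately show "precedes (prod.swap ` A) (prod.swap ` B)" using precedes_swap by blast
  qed
  moreover have "sum (w \<circ> prod.swap) (prod.swap ` V) = sum w V"
    by (simp add: sum.reindex o_def)
  moreover have "score (w \<circ> prod.swap) A = score w (prod.swap ` A)" for A
    unfolding score_def by (simp add: sum.reindex)
  moreover have "inj_on (image prod.swap) T"
    by (simp add: inj_on_def inj_image_eq_iff)
  ultimately have "sum w V \<le> real (2 * D + 1) * (\<Sum>A\<in>image prod.swap ` T. score w A)"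
    using T(3) by (simp add: sum.reindex)
  moreover have "image prod.swap ` T \<subseteq> column_segments B D m"
    unfolding column_segments_def using T(1) by (rule image_mono)
  ultimately show ?thesis using \<open>non_conflicting (image prod.swap ` T)\<close> by blast
qed

section \<open>Lattice paths, their split by step direction, and the table score\<close>

lemma grid_path_mono:
  assumes "grid_path m p" "i \<le> j" "j < length p"
  shows "fst (p ! i) \<le> fst (p ! j) \<and> snd (p ! i) \<le> snd (p ! j)"
  using assms(2,3)
proof (induction j rule: dec_induct)
  case (step j)
  then have "up_right_step (p ! j) (p ! Suc j)" using assms(1) unfolding grid_path_def by blast
  then show ?case using step unfolding up_right_step_def by auto
qed simp

text \<open>A cell of \<open>H\<close> is left by a step to the right, so every later cell of the
  path has a larger column; a cell in a higher row must be later. For \<open>V\<close> the roles of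
  rows and columns are exchanged.\<close>

lemma grid_path_split:
  assumes p: "grid_path m p" and "m \<ge> 1"
  obtains H V where "set p = H \<union> V"
    "\<And>x y. x \<in> H \<Longrightarrow> y \<in> H \<Longrightarrow> fst x < fst y \<Longrightarrow> snd x < snd y"
    "\<And>x y. x \<in> V \<Longrightarrow> y \<in> V \<Longrightarrow> snd x < snd y \<Longrightarrow> fst x < fst y"
proof -
  let ?n = "length p"
  \<comment> \<open>The last cell has no successor; the implication is vacuous there and puts its
    index into \<open>I\<close>.\<close>
  define I where "I = {i. i < ?n \<and> (Suc i < ?n \<longrightarrow> p ! Suc i = (fst (p ! i), Suc (snd (p ! i))))}"
  define J where "J = {i. Suc i < ?n \<and> p ! Suc i = (Suc (fst (p ! i)), snd (p ! i))}"
  have step: "up_right_step (p ! i) (p ! Suc i)" if "Suc i < ?n" for i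
    using p that unfolding grid_path_def by blast
  have "{..<?n} = I \<union> J"
    using step unfolding I_def J_def up_right_step_def by auto
  then have "set p = (!) p ` I \<union> (!) p ` J"
    by (metis image_Un nth_image order_refl take_all lessThan_atLeast0)
  moreover have "snd x < snd y" if xy: "x \<in> (!) p ` I" "y \<in> (!) p ` I" "fst x < fst y" for x y
  proof -
    obtain i j where ij: "i \<in> I" "j \<in> I" "x = p ! i" "y = p ! j" using xy by blast
    \<comment> \<open>Otherwise monotonicity of the path would give
      \<open>fst y \<le> fst x\<close>.\<close>
    then have "i < j"
      using grid_path_mono[OF p, of j i] xy(3) unfolding I_def by (force simp: not_less)
    then show ?thesis
      using grid_path_mono[OF p, of "Suc i" j] ij unfolding I_def by auto
  qed
  moreover have "fst x < fst y" if xy: "x \<in> (!) p ` J" "y \<in> (!) p ` J" "snd x < snd y" for x y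
  proof -
    obtain i j where ij: "i \<in> J" "j \<in> J" "x = p ! i" "y = p ! j" using xy by blast
    then have "i < j"
      using grid_path_mono[OF p, of j i] xy(3) unfolding J_def by (force simp: not_less)
    then show ?thesis
      using grid_path_mono[OF p, of "Suc i" j] ij unfolding J_def by auto
  qed
  ultimately show ?thesis by (rule that)
qed

lemma grid_path_exists:
  assumes "m \<ge> 1"
  shows "\<exists>p. grid_path m p"
proof
  \<comment> \<open>Up the leftmost column, then right along the top row; index \<open>m\<close> is
    the cell in column 1, since the corner has index \<open>m - 1\<close>.\<close>
  let ?f = "\<lambda>i. if i < m then (i, 0) else (m - 1, i + 1 - m)"
  let ?p = "map ?f [0..<2 * m - 1]"
  have "?p \<noteq> []" using assms by simp
  then have "hd ?p = ?p ! 0" "last ?p = ?p ! (length ?p - 1)"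
    by (rule hd_conv_nth, rule last_conv_nth)
  then have "hd ?p = (0, 0)" "last ?p = (m - 1, m - 1)"
    using assms by auto
  then show "grid_path m ?p"
    unfolding grid_path_def up_right_step_def cells_def using assms by auto
qed

text \<open>Paths are lists of fixed length over a finite set and at least one exists, so the
  \<open>Max\<close> is the score of an actual path.\<close>

lemma table_score_attained:
  assumes "m \<ge> 1"
  obtains p where "grid_path m p" "table_score m w = score w (set p)"
proof -
  let ?Q = "{p. grid_path m p}"
  have "?Q \<subseteq> {p. set p \<subseteq> cells m \<and> length p = 2 * m - 1}"
    unfolding grid_path_def by auto
  moreover have "finite {p. set p \<subseteq> cells m \<and> length p = 2 * m - 1}"
    by (rule finite_lists_length_eq) (simp add: cells_def)
  ultimately have "finite ?Q" by (rule finite_subset)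
  moreover have eq: "{score w (set p) | p. grid_path m p} = (\<lambda>p. score w (set p)) ` ?Q" by auto
  moreover have "?Q \<noteq> {}" using grid_path_exists[OF assms] by auto
  ultimately have "table_score m w \<in> (\<lambda>p. score w (set p)) ` ?Q"
    unfolding table_score_def eq by (intro Max_in) auto
  then show ?thesis using that by auto
qed

section \<open>The block segments as an approximate solution\<close>

text \<open>The outer factor 2 in \<alpha> comes from uniting row and column segments, the one in
  \<beta> from keeping only the heavier of the two classes of path cells; \<open>2 * D + 1\<close>
  is the loss within a class.\<close>

lemma approximate_solution_block_segments:
  assumes "m \<ge> 1" "B > 0" "m \<le> B ^ D"
  shows "approximate_solution m (real (2 * ((D + 1) * (B * B)))) (real (2 * (2 * D + 1)))
    (mset_set (row_segments B D m \<union> column_segments B D m))"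
proof -
  let ?F = "row_segments B D m \<union> column_segments B D m"
  have finF: "finite ?F" using finite_row_segments finite_column_segments by blast
  have "grid_solution m (mset_set ?F)"
    unfolding grid_solution_def using finF segment_row_segments segment_column_segments \<open>B > 0\<close>
    by auto
  moreover have "size {#A \<in># mset_set ?F. x \<in> A#} \<le> 2 * ((D + 1) * (B * B))" for x
  proof -
    have "{A \<in> ?F. x \<in> A} = {A \<in> row_segments B D m. x \<in> A} \<union> {A \<in> column_segments B D m. x \<in> A}"
      by blast
    then have "card {A \<in> ?F. x \<in> A}
        \<le> card {A \<in> row_segments B D m. x \<in> A} + card {A \<in> column_segments B D m. x \<in> A}"
      by (simp only: card_Un_le)
    then show ?thesis
      using card_row_segments_containing[OF \<open>B > 0\<close>, of D m x]
        card_column_segments_containing[OF \<open>B > 0\<close>, of D m x] finF by simp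
  qed
  moreover have "\<exists>T \<subseteq> set_mset (mset_set ?F). non_conflicting T \<and>
      (\<Sum>A\<in>T. score w A) \<ge> 1 / real (2 * (2 * D + 1)) * table_score m w"
    if w: "\<forall>x\<in>cells m. w x \<ge> 0" for w
  proof -
    obtain p where p: "grid_path m p" "table_score m w = score w (set p)"
      using table_score_attained[OF \<open>m \<ge> 1\<close>] by blast
    obtain H V where HV: "set p = H \<union> V"
      "\<And>x y. x \<in> H \<Longrightarrow> y \<in> H \<Longrightarrow> fst x < fst y \<Longrightarrow> snd x < snd y"
      "\<And>x y. x \<in> V \<Longrightarrow> y \<in> V \<Longrightarrow> snd x < snd y \<Longrightarrow> fst x < fst y"
      using grid_path_split[OF p(1) \<open>m \<ge> 1\<close>] by blast
    have sub: "H \<subseteq> cells m" "V \<subseteq> cells m"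
      using p(1) HV(1) unfolding grid_path_def by auto
    obtain T1 where T1: "T1 \<subseteq> row_segments B D m" "non_conflicting T1"
      "sum w H \<le> real (2 * D + 1) * (\<Sum>A\<in>T1. score w A)"
      using heavy_row_segments[OF assms(2,3) w sub(1) HV(2)] by blast
    obtain T2 where T2: "T2 \<subseteq> column_segments B D m" "non_conflicting T2"
      "sum w V \<le> real (2 * D + 1) * (\<Sum>A\<in>T2. score w A)"
      using heavy_column_segments[OF assms(2,3) w sub(2) HV(3)] by blast
    have "finite (H \<union> V)" using HV(1) by (metis finite_set)
    \<comment> \<open>\<open>H\<close> and \<open>V\<close> are only known to cover the path; a
      possible overlap has non-negative weight, which suffices for an upper bound.\<close>
    moreover have "sum w (H \<inter> V) \<ge> 0" using w sub by (intro sum_nonneg) auto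
    ultimately have total: "table_score m w \<le> sum w H + sum w V"
      unfolding p(2) score_def HV(1) by (simp add: sum_Un)
    define k where "k = real (2 * D + 1)"
    have k: "k > 0" unfolding k_def by simp
    have *: "1 / real (2 * (2 * D + 1)) * table_score m w \<le> s"
      if "table_score m w \<le> 2 * (k * s)" for s
      using that k unfolding of_nat_mult k_def[symmetric] by (simp add: field_simps)
    show ?thesis
    proof (cases "sum w V \<le> sum w H")
      case True
      then have "table_score m w \<le> 2 * (k * (\<Sum>A\<in>T1. score w A))"
        using total T1(3) unfolding k_def by simp
      from *[OF this] show ?thesis using T1 finF by auto
    next
      case False
      then have "table_score m w \<le> 2 * (k * (\<Sum>A\<in>T2. score w A))"
        using total T2(3) unfolding k_def by simp
      from *[OF this] show ?thesis using T2 finF by auto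
    qed
  qed
  ultimately show ?thesis
    unfolding approximate_solution_def by (auto simp flip: of_nat_mult of_nat_add)
qed

section \<open>Choice of the parameters\<close>

lemma ex_nat_ge:
  fixes y :: real
  assumes "y \<ge> 0"
  obtains n :: nat where "y \<le> real n" "real n \<le> y + 1"
proof -
  have "real (nat \<lceil>y\<rceil>) = of_int \<lceil>y\<rceil>" using assms by simp
  then show ?thesis
    using that[of "nat \<lceil>y\<rceil>"] le_of_int_ceiling[of y] of_int_ceiling_le_add_one[of y] by simp
qed

theorem theorem3:
  "\<exists>C\<^sub>1 > 0. \<exists>C\<^sub>2 > 0. \<forall>(\<kappa>::real) (m::nat). 0 < \<kappa> \<longrightarrow> \<kappa> < 1 \<longrightarrow> m \<ge> 1 \<longrightarrow>
     (\<exists>S \<alpha> \<beta>. \<alpha> \<le> C\<^sub>1 * (real m powr \<kappa> * max 1 (log 2 (real m))) \<and> \<beta> \<le> C\<^sub>2 * (1 / \<kappa>) \<and>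
        approximate_solution m \<alpha> \<beta> S)"
proof -
  \<comment> \<open>24 is 2 for rows and columns, times 3 from \<open>D + 1\<close>, times 4 from
    \<open>B * B\<close>. 14 comes from \<open>4 * D + 2\<close> with
    \<open>D \<le> 2 / \<kappa> + 1\<close> and \<open>1 \<le> 1 / \<kappa>\<close>.\<close>
  have "\<exists>S \<alpha> \<beta>. \<alpha> \<le> 24 * (real m powr \<kappa> * max 1 (log 2 (real m))) \<and> \<beta> \<le> 14 * (1 / \<kappa>) \<and>
        approximate_solution m \<alpha> \<beta> S"
    if \<kappa>: "0 < \<kappa>" "\<kappa> < 1" and m: "m \<ge> 1" for \<kappa> :: real and m :: nat
  proof -
    \<comment> \<open>Coverage grows with \<open>B * B\<close>, hence the exponent
      \<open>\<kappa> / 2\<close>.\<close>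
    define x where "x = real m powr (\<kappa> / 2)"
    have x: "x \<ge> 1" unfolding x_def using m \<kappa> by (intro ge_one_powr_ge_zero) auto
    then obtain n where n: "x \<le> real n" "real n \<le> x + 1" using ex_nat_ge[of x] by auto
    \<comment> \<open>The lower bound 2 makes \<open>B\<close> a proper base of logarithms with
      \<open>log B m \<le> log 2 m\<close>; \<open>B \<le> 2 * x\<close> survives because
      \<open>x \<ge> 1\<close>.\<close>
    define B where "B = max 2 n"
    have B: "B \<ge> 2" "real B \<ge> x" "real B \<le> 2 * x" unfolding B_def using x n by auto
    have "log B m \<ge> 0" using B m by simp
    then obtain D where D: "log B m \<le> real D" "real D \<le> log B m + 1" by (rule ex_nat_ge)
    have "real m = real B powr log B m" using B m by simp
    also have "\<dots> \<le> real B powr real D" using B D by (intro powr_mono) auto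
    also have "\<dots> = real (B ^ D)" using B by (simp add: powr_realpow)
    finally have "m \<le> B ^ D" by linarith
    then have "approximate_solution m (real (2 * ((D + 1) * (B * B)))) (real (2 * (2 * D + 1)))
      (mset_set (row_segments B D m \<union> column_segments B D m))"
      using approximate_solution_block_segments m B by simp
    moreover have "real (2 * ((D + 1) * (B * B))) \<le> 24 * (real m powr \<kappa> * max 1 (log 2 (real m)))"
    proof -
      have "log B m \<le> log 2 m"
        using B m by (simp add: log_def divide_left_mono)
      then have "real (D + 1) \<le> 3 * max 1 (log 2 m)" using D by simp
      moreover have "real (B * B) \<le> 4 * real m powr \<kappa>"
      proof -
        have "real (B * B) \<le> (2 * x) * (2 * x)" unfolding of_nat_mult using B by (intro mult_mono) auto
        also have "\<dots> = 4 * real m powr \<kappa>" unfolding x_def by (simp flip: powr_add)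
        finally show ?thesis .
      qed
      ultimately have "real (D + 1) * real (B * B)
          \<le> (3 * max 1 (log 2 m)) * (4 * real m powr \<kappa>)"
        by (intro mult_mono) auto
      then show ?thesis by (simp add: algebra_simps)
    qed
    moreover have "real (2 * (2 * D + 1)) \<le> 14 * (1 / \<kappa>)"
    proof -
      \<comment> \<open>As \<open>B\<close> is at least \<open>m powr (\<kappa> / 2)\<close>, about
        \<open>2 / \<kappa>\<close> scales reach \<open>m\<close>.\<close>
      have "ln (real m) * (\<kappa> / 2) = ln x" unfolding x_def using m by simp
      also have "\<dots> \<le> ln (real B)" using B x by simp
      finally have "log B m \<le> 2 / \<kappa>"
        unfolding log_def using B \<kappa> by (simp add: field_simps)
      moreover have "1 \<le> 1 / \<kappa>" using \<kappa> by simp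
      ultimately show ?thesis using D by simp
    qed
    ultimately show ?thesis by blast
  qed
  then show ?thesis
    by (intro exI[of _ "24::real"] exI[of _ "14::real"] conjI) auto
qed

end
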